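(* For $n\ge 0$ let $\mathrm{RSL}(n)=(-1)^{\mathrm{inv}_2(n)}$, where $\mathrm{inv}_2(n)$ is the number of occurrences of $10$ as a scattered subsequence in the binary representation of $n$. Then the inequality $$\sup_{\theta\in\mathbb{R}}\left|\sum_{0\le n<N}\mathrm{RSL}(n)\,e^{2\pi i n\theta}\right|\le C\,N^{1/2}$$ does not hold for the sequence $\mathrm{RSL}$; that is, there is no constant $C>0$ such that it holds for all integers $N\ge 1$.
   Context: An occurrence of $10$ as a scattered subsequence in the binary representation of $n$ is a pair of (not necessarily adjacent) digit positions such that the more significant position carries the digit $1$ and the less significant position carries the digit $0$; $\mathrm{inv}_2(n)$ counts all such pairs. For example, $\mathrm{inv}_2(0)=\mathrm{inv}_2(1)=0$, $\mathrm{inv}_2(2)=1$, $\mathrm{inv}_2(4)=2$, $\mathrm{inv}_2(5)=1$. *)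

theory Defs
  imports Complex_Main
begin

text \<open>The condition \<open>bit n i\<close> bounds \<open>i\<close>, hence also \<open>j\<close>, by the length of the binary
  representation of \<open>n\<close>, so leading zeros never contribute and the set is finite.\<close>

definition inv2 :: "nat \<Rightarrow> nat" where
  "inv2 n = card {(i, j). j < i \<and> bit n i \<and> \<not> bit n j}"

definition RSL :: "nat \<Rightarrow> int" where
  "RSL n = (- 1) ^ inv2 n"

end

theory Submission
  imports Defs
begin

text \<open>Let \<open>s n\<close> be the number of ones in the binary representation of \<open>n\<close>. The generating polynomials
  \<open>P\<^sub>k, Q\<^sub>k\<close> of \<open>RSL n\<close> and \<open>(-1) ^ s n * RSL n\<close> over \<open>n < 2 ^ k\<close> satisfy
  \<open>P\<^sub>k\<^sub>+\<^sub>1(z) = z P\<^sub>k(z\<^sup>2) + Q\<^sub>k(z\<^sup>2)\<close> and \<open>Q\<^sub>k\<^sub>+\<^sub>1(z) = P\<^sub>k(z\<^sup>2) - z Q\<^sub>k(z\<^sup>2)\<close>. Squaring swaps the two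
  primitive cube roots of unity, so at \<open>z = exp (2 \<pi> \<i> / 3)\<close> two steps amount to multiplication by
  the matrix with rows \<open>(2, \<i>\<surd>3)\<close> and \<open>(-\<i>\<surd>3, 2)\<close>. Its larger eigenvalue \<open>2 + \<surd>3\<close> exceeds \<open>2\<close>, whereas
  the square root of \<open>2 ^ k\<close> grows only by the factor \<open>2\<close> in two steps.\<close>

definition bit_count :: "nat \<Rightarrow> nat" where
  "bit_count n = card {i. bit n i}"

text \<open>A set bit \<open>i\<close> forces \<open>2 ^ i \<le> n\<close>, and
  \<open>i < 2 ^ i\<close>. This crude bound is enough for the finiteness that the cardinalities
  need.\<close>

lemma bit_nat_imp_less:
  assumes "bit (n::nat) i"
  shows "i < n"
proof -
  have "n div 2 ^ i \<noteq> 0"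
    using assms by (metis bit_iff_odd even_zero)
  hence "2 ^ i \<le> n"
    by (simp add: div_eq_0_iff)
  thus ?thesis
    using less_exp[of i] by linarith
qed

lemma finite_bits_nat: "finite {i. bit (n::nat) i}"
  by (rule finite_subset[of _ "{..<n}"]) (auto dest: bit_nat_imp_less)

lemma finite_inversions: "finite {(i, j). j < i \<and> bit (n::nat) i \<and> \<not> bit n j}"
  by (rule finite_subset[of _ "{..<n} \<times> {..<n}"]) (auto dest: bit_nat_imp_less)

lemma bit_double_nat: "bit (2 * n :: nat) i \<longleftrightarrow> (\<exists>k. i = Suc k \<and> bit n k)"
  by (cases i) (auto simp: bit_0 bit_Suc)

lemma bit_Suc_double_nat: "bit (Suc (2 * n)) i \<longleftrightarrow> i = 0 \<or> (\<exists>k. i = Suc k \<and> bit n k)"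
  by (cases i) (auto simp: bit_0 bit_Suc)

lemma bit_count_double: "bit_count (2 * n) = bit_count n"
proof -
  have "{i. bit (2 * n) i} = Suc ` {i. bit n i}"
    by (auto simp: bit_double_nat)
  thus ?thesis
    by (simp add: bit_count_def card_image)
qed

lemma bit_count_Suc_double: "bit_count (Suc (2 * n)) = Suc (bit_count n)"
proof -
  have "{i. bit (Suc (2 * n)) i} = insert 0 (Suc ` {i. bit n i})"
    by (auto simp: bit_Suc_double_nat)
  thus ?thesis
    by (simp add: bit_count_def card_image finite_bits_nat)
qed

text \<open>A final digit 1 has nothing below it and is not a 0, so it joins no pair; the old pairs
  just shift up by one position.\<close>

lemma inv2_Suc_double: "inv2 (Suc (2 * n)) = inv2 n"
proof -
  have "{(i, j). j < i \<and> bit (Suc (2 * n)) i \<and> \<not> bit (Suc (2 * n)) j} =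
      map_prod Suc Suc ` {(i, j). j < i \<and> bit n i \<and> \<not> bit n j}" (is "?L = ?R")
  proof
    show "?L \<subseteq> ?R"
    proof clarify
      fix i j
      assume ij: "j < i" "bit (Suc (2 * n)) i" "\<not> bit (Suc (2 * n)) j"
      then obtain k l where "i = Suc k" "j = Suc l"
        by (metis bit_Suc_double_nat not_less0 old.nat.exhaust)
      with ij show "(i, j) \<in> ?R"
        by (auto simp: bit_Suc_double_nat)
    qed
  qed (auto simp: bit_Suc_double_nat)
  thus ?thesis
    by (simp add: inv2_def card_image inj_on_def)
qed

text \<open>A final digit 0 pairs with every 1 above it (\<open>?B\<close>), in addition to the
  shifted old pairs (\<open>?S\<close>).\<close>

lemma inv2_double: "inv2 (2 * n) = inv2 n + bit_count n"
proof -
  let ?S = "map_prod Suc Suc ` {(i, j). j < i \<and> bit n i \<and> \<not> bit n j}"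
  let ?B = "(\<lambda>i. (Suc i, 0::nat)) ` {i. bit n i}"
  have "{(i, j). j < i \<and> bit (2 * n) i \<and> \<not> bit (2 * n) j} = ?S \<union> ?B" (is "?L = _")
  proof
    show "?L \<subseteq> ?S \<union> ?B"
    proof clarify
      fix i j
      assume ij: "j < i" "bit (2 * n) i" "\<not> bit (2 * n) j" "(i, j) \<notin> ?B"
      then obtain k l where "i = Suc k" "j = Suc l"
        by (cases j) (auto simp: bit_double_nat)
      with ij show "(i, j) \<in> ?S"
        by (auto simp: bit_double_nat)
    qed
  qed (auto simp: bit_double_nat)
  hence "inv2 (2 * n) = card (?S \<union> ?B)"
    by (simp add: inv2_def)
  also have "\<dots> = card ?S + card ?B"
    by (rule card_Un_disjoint) (auto simp: finite_inversions finite_bits_nat)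
  also have "card ?S = inv2 n"
    by (simp add: inv2_def card_image inj_on_def)
  also have "card ?B = bit_count n"
    by (simp add: bit_count_def card_image inj_on_def)
  finally show ?thesis .
qed

definition RSL_poly :: "nat \<Rightarrow> 'a::comm_ring_1 \<Rightarrow> 'a" where
  "RSL_poly m z = (\<Sum>n<m. of_int (RSL n) * z ^ n)"

text \<open>The twist is the sign that \<open>inv2_double\<close> creates at even indices; adjoining
  this second polynomial closes the recursion.\<close>

definition RSL_twist_poly :: "nat \<Rightarrow> 'a::comm_ring_1 \<Rightarrow> 'a" where
  "RSL_twist_poly m z = (\<Sum>n<m. of_int (RSL n) * (- 1) ^ bit_count n * z ^ n)"

lemma sum_lessThan_double:
  fixes f :: "nat \<Rightarrow> 'a::comm_monoid_add"
  shows "(\<Sum>n<2 * m. f n) = (\<Sum>n<m. f (2 * n) + f (Suc (2 * n)))"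
  by (induction m) (simp_all add: add.assoc)

lemma RSL_poly_double:
  "RSL_poly (2 * m) z = z * RSL_poly m (z\<^sup>2) + RSL_twist_poly m (z\<^sup>2)"
  unfolding RSL_poly_def RSL_twist_poly_def sum_lessThan_double sum_distrib_left sum.distrib[symmetric]
proof (intro sum.cong refl)
  fix n
  show "of_int (RSL (2 * n)) * z ^ (2 * n) + of_int (RSL (Suc (2 * n))) * z ^ Suc (2 * n)
      = z * (of_int (RSL n) * z\<^sup>2 ^ n) + of_int (RSL n) * (- 1) ^ bit_count n * z\<^sup>2 ^ n"
    unfolding RSL_def inv2_double inv2_Suc_double power_mult power_add power_Suc
    by (simp add: ac_simps)
qed

text \<open>At even indices the twist meets the sign from \<open>inv2_double\<close> and cancels; at
  odd indices the extra digit 1 produces the minus sign.\<close>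

lemma RSL_twist_poly_double:
  "RSL_twist_poly (2 * m) z = RSL_poly m (z\<^sup>2) - z * RSL_twist_poly m (z\<^sup>2)"
  unfolding RSL_poly_def RSL_twist_poly_def sum_lessThan_double sum_distrib_left sum_subtractf[symmetric]
proof (intro sum.cong refl)
  fix n
  have "(- 1 :: 'a) ^ bit_count n * (- 1) ^ bit_count n = 1"
    by (simp flip: power_mult_distrib)
  hence even: "of_int (RSL (2 * n)) * (- 1 :: 'a) ^ bit_count (2 * n) = of_int (RSL n)"
    by (simp add: RSL_def inv2_double bit_count_double power_add mult.assoc)
  have odd: "of_int (RSL (Suc (2 * n))) * (- 1 :: 'a) ^ bit_count (Suc (2 * n))
      = - (of_int (RSL n) * (- 1) ^ bit_count n)"
    by (simp add: RSL_def inv2_Suc_double bit_count_Suc_double)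
  show "of_int (RSL (2 * n)) * (- 1) ^ bit_count (2 * n) * z ^ (2 * n)
        + of_int (RSL (Suc (2 * n))) * (- 1) ^ bit_count (Suc (2 * n)) * z ^ Suc (2 * n)
      = of_int (RSL n) * z\<^sup>2 ^ n - z * (of_int (RSL n) * (- 1) ^ bit_count n * z\<^sup>2 ^ n)"
    unfolding even odd power_mult power_Suc by (simp add: ac_simps)
qed

text \<open>Since \<open>w ^ 4 = w\<close>, two doublings return to the argument \<open>w\<close>;
  the diagonal coefficient is \<open>1 + w ^ 3 = 2\<close>.\<close>

lemma RSL_poly_quadruple:
  fixes w :: "'a::comm_ring_1"
  assumes "w ^ 3 = 1"
  shows "RSL_poly (4 * m) w = 2 * RSL_poly m w + (w - w\<^sup>2) * RSL_twist_poly m w"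
    and "RSL_twist_poly (4 * m) w = 2 * RSL_twist_poly m w - (w - w\<^sup>2) * RSL_poly m w"
proof -
  have w4: "(w\<^sup>2)\<^sup>2 = w" and w3: "w * w\<^sup>2 = 1"
    using assms by (simp_all add: power2_eq_square power3_eq_cube mult.assoc)
  have w3': "w * (w\<^sup>2 * x) = x" for x
    by (metis w3 mult.assoc mult_1)
  have w3'': "w * (x * w\<^sup>2) = x" for x
    by (metis w3' mult.commute)
  have four: "4 * m = 2 * (2 * m)"
    by simp
  show "RSL_poly (4 * m) w = 2 * RSL_poly m w + (w - w\<^sup>2) * RSL_twist_poly m w"
    unfolding four RSL_poly_double RSL_twist_poly_double w4 by (simp add: algebra_simps w3' w3'')
  show "RSL_twist_poly (4 * m) w = 2 * RSL_twist_poly m w - (w - w\<^sup>2) * RSL_poly m w"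
    unfolding four RSL_poly_double RSL_twist_poly_double w4 by (simp add: algebra_simps w3' w3'')
qed

lemma cis_third_minus_square: "cis (2 * pi / 3) - (cis (2 * pi / 3))\<^sup>2 = \<i> * sqrt 3"
proof -
  have "sin (4 * pi / 3) = - sin (pi / 3)" "cos (4 * pi / 3) = - cos (pi / 3)"
    using sin_periodic_pi[of "pi / 3"] cos_periodic_pi[of "pi / 3"] by (simp_all add: field_simps)
  moreover have "(cis (2 * pi / 3))\<^sup>2 = cis (4 * pi / 3)"
    by (simp add: Complex.DeMoivre)
  ultimately show ?thesis
    by (simp add: complex_eq_iff cos_120 sin_120 cos_60 sin_60)
qed

text \<open>The initial vector (1, 1) is split along the eigenvectors (1, -\<open>\<i>\<close>) and
  (1, \<open>\<i>\<close>), with eigenvalues \<open>2 + sqrt 3\<close> and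
  \<open>2 - sqrt 3\<close>. The recursion couples the two formulas, so one induction proves
  both.\<close>

lemma RSL_poly_cube_root:
  defines "w \<equiv> cis (2 * pi / 3)"
  shows "2 * RSL_poly (4 ^ k) w = (1 + \<i>) * (2 + sqrt 3) ^ k + (1 - \<i>) * (2 - sqrt 3) ^ k"
    and "2 * RSL_twist_poly (4 ^ k) w = (1 - \<i>) * (2 + sqrt 3) ^ k + (1 + \<i>) * (2 - sqrt 3) ^ k"
proof (induction k)
  case 0
  have "inv2 0 = 0"
    by (simp add: inv2_def)
  moreover have "bit_count 0 = 0"
    by (simp add: bit_count_def)
  ultimately show "2 * RSL_poly (4 ^ 0) w = (1 + \<i>) * (2 + sqrt 3) ^ 0 + (1 - \<i>) * (2 - sqrt 3) ^ 0"
    and "2 * RSL_twist_poly (4 ^ 0) w = (1 - \<i>) * (2 + sqrt 3) ^ 0 + (1 + \<i>) * (2 - sqrt 3) ^ 0"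
    by (simp_all add: RSL_poly_def RSL_twist_poly_def RSL_def)
next
  case (Suc k)
  define a b where "a = (2 + complex_of_real (sqrt 3)) ^ k" and "b = (2 - complex_of_real (sqrt 3)) ^ k"
  have w: "w ^ 3 = 1"
    by (simp add: w_def Complex.DeMoivre)
  note quad = RSL_poly_quadruple[OF w, of "4 ^ k", unfolded w_def cis_third_minus_square, folded w_def]
  have IH: "2 * RSL_poly (4 ^ k) w = (1 + \<i>) * a + (1 - \<i>) * b"
    "2 * RSL_twist_poly (4 ^ k) w = (1 - \<i>) * a + (1 + \<i>) * b"
    using Suc by (simp_all add: a_def b_def)
  have "2 * RSL_poly (4 ^ Suc k) w
      = 2 * (2 * RSL_poly (4 ^ k) w) + \<i> * sqrt 3 * (2 * RSL_twist_poly (4 ^ k) w)"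
    by (simp add: quad algebra_simps)
  also have "\<dots> = (1 + \<i>) * (2 + sqrt 3) * a + (1 - \<i>) * (2 - sqrt 3) * b"
    \<comment> \<open>Here \<open>\<i> * (1 - \<i>) = 1 + \<i>\<close> and
      \<open>\<i> * (1 + \<i>) = - (1 - \<i>)\<close>.\<close>
    unfolding IH by (simp add: algebra_simps)
  finally show "2 * RSL_poly (4 ^ Suc k) w
      = (1 + \<i>) * (2 + sqrt 3) ^ Suc k + (1 - \<i>) * (2 - sqrt 3) ^ Suc k"
    by (simp add: a_def b_def mult.assoc)
  have "2 * RSL_twist_poly (4 ^ Suc k) w
      = 2 * (2 * RSL_twist_poly (4 ^ k) w) - \<i> * sqrt 3 * (2 * RSL_poly (4 ^ k) w)"
    by (simp add: quad algebra_simps)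
  also have "\<dots> = (1 - \<i>) * (2 + sqrt 3) * a + (1 + \<i>) * (2 - sqrt 3) * b"
    unfolding IH by (simp add: algebra_simps)
  finally show "2 * RSL_twist_poly (4 ^ Suc k) w
      = (1 - \<i>) * (2 + sqrt 3) ^ Suc k + (1 + \<i>) * (2 - sqrt 3) ^ Suc k"
    by (simp add: a_def b_def mult.assoc)
qed

lemma norm_RSL_poly_cube_root_ge: "(2 + sqrt 3) ^ k \<le> 2 * cmod (RSL_poly (4 ^ k) (cis (2 * pi / 3)))"
proof -
  have "sqrt 3 \<le> 2"
    by (rule real_le_lsqrt) auto
  hence "(2 + sqrt 3) ^ k \<le> (2 + sqrt 3) ^ k + (2 - sqrt 3) ^ k"
    by simp
  also have "\<dots> = Re ((1 + \<i>) * of_real ((2 + sqrt 3) ^ k) + (1 - \<i>) * of_real ((2 - sqrt 3) ^ k))"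
    by (simp del: of_real_power)
  also have "\<dots> = Re (2 * RSL_poly (4 ^ k) (cis (2 * pi / 3)))"
    by (simp add: RSL_poly_cube_root)
  also have "\<dots> \<le> cmod (2 * RSL_poly (4 ^ k) (cis (2 * pi / 3)))"
    by (rule complex_Re_le_cmod)
  finally show ?thesis
    by (simp add: norm_mult)
qed

theorem mainTheorem2:
  "\<not> (\<exists>C::real. C > 0 \<and>
      (\<forall>N::nat. N \<ge> 1 \<longrightarrow>
        (SUP \<theta>::real. cmod (\<Sum>n<N. of_int (RSL n) * exp (2 * of_real pi * \<i> * of_nat n * of_real \<theta>)))
          \<le> C * real N powr (1 / 2)))"
proof
  define F where "F = (\<lambda>N \<theta>. cmod (\<Sum>n<N. of_int (RSL n) *
    exp (2 * of_real pi * \<i> * of_nat n * of_real \<theta>)))"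
  assume "\<exists>C::real. C > 0 \<and> (\<forall>N::nat. N \<ge> 1 \<longrightarrow>
    (SUP \<theta>::real. cmod (\<Sum>n<N. of_int (RSL n) * exp (2 * of_real pi * \<i> * of_nat n * of_real \<theta>)))
      \<le> C * real N powr (1 / 2))"
  then obtain C where C: "\<And>N. N \<ge> 1 \<Longrightarrow> (SUP \<theta>::real. F N \<theta>) \<le> C * real N powr (1 / 2)"
    unfolding F_def by blast
  \<comment> \<open>The trivial bound makes the range of \<open>F N\<close> bounded above, so that
    the real supremum really dominates each value.\<close>
  have F_le: "F N \<theta> \<le> real N" for N \<theta>
  proof -
    have "cmod (of_int (RSL n) * exp (2 * of_real pi * \<i> * of_nat n * of_real \<theta>)) \<le> 1" for n
      by (simp add: RSL_def norm_mult norm_power)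
    thus ?thesis
      unfolding F_def by (intro order.trans[OF norm_sum] order.trans[OF sum_bounded_above[where K = 1]]) auto
  qed
  have F_third: "F N (1 / 3) = cmod (RSL_poly N (cis (2 * pi / 3)))" for N
    unfolding F_def RSL_poly_def
    by (intro arg_cong[where f = cmod] sum.cong refl)
      (simp add: Complex.DeMoivre cis_conv_exp mult_ac flip: exp_of_nat_mult)
  \<comment> \<open>At \<open>N = 4 ^ k\<close> the square root is \<open>2 ^ k\<close>; dividing by
    it leaves powers of a ratio greater than 1, which cannot stay bounded.\<close>
  have bound: "((2 + sqrt 3) / 2) ^ k \<le> 2 * C" for k
  proof -
    have "F (4 ^ k) (1 / 3) \<le> (SUP \<theta>. F (4 ^ k) \<theta>)"
      by (rule cSUP_upper) (auto intro!: bdd_aboveI2 F_le)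
    also have "\<dots> \<le> C * real (4 ^ k) powr (1 / 2)"
      by (rule C) simp
    also have "real (4 ^ k) powr (1 / 2) = 2 ^ k"
      by (simp add: powr_half_sqrt real_sqrt_power)
    finally have "(2 + sqrt 3) ^ k \<le> 2 * (C * 2 ^ k)"
      using norm_RSL_poly_cube_root_ge[of k] by (simp add: F_third)
    thus ?thesis
      by (simp add: power_divide field_simps)
  qed
  obtain k where "2 * C < ((2 + sqrt 3) / 2) ^ k"
    using real_arch_pow[of "(2 + sqrt 3) / 2" "2 * C"] by auto
  with bound[of k] show False
    by simp
qed

end
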